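(* For any $L\ge 0$, integers $t\ge k\ge 2$, and $\delta>0$, there exists a constant $c>0$ such that the following holds. For any positive integer $n$ and any union $\mathcal{F}$ of $n^{1-\delta}$ many $\frac{1}{k-1}$-dense sequences of $k$-graphs, there exist an $n$-vertex $k$-graph $H$ and an edge coloring of $H$ with $Ln$ colors such that: (i) each color class is (a copy of) $K_t^{(k)}$, and (ii) the minimum size $|F|$ of a $k$-graph $F\in\mathcal{F}$ such that there exists a rainbow copy of $F$ in $H$ is at least $c\log n$.
   Context: A $k$-uniform hypergraph ($k$-graph) $F$ is a finite collection of $k$-sets; its vertex set is $V(F)=\bigcup_{e\in F}e$ and its elements are edges. $K_t^{(k)}$ is the collection of all $k$-subsets of a $t$-element set. The density of $F$ is $|F|/|V(F)|$. A $\frac{1}{k-1}$-dense sequence of $k$-graphs is a sequence $(F_\ell)_{\ell\ge 2}$ of $k$-graphs such that for each $\ell$, $|F_\ell|=\ell$ and $|V(F_\ell)|\le \ell(k-1)$ (equivalently density at least $\frac{1}{k-1}$). An edge coloring of $H$ with $m$ colors is a map $\lambda:H\to[m]$; the sets $\lambda^{-1}(i)$ are the color classes. A sub-hypergraph (copy) is rainbow if no two of its edges lie in the same color class.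
   Formalization: "Any positive integer n" fails for small n (e.g. n < t with L > 0); proved for all n at least a constant depending on L, k, t, δ, and for every smaller n where some n-vertex k-graph has a coloring as in (i). Ln is rounded up. *)

theory Defs
  imports Complex_Main
begin

text \<open>A hypergraph is identified with its set of edges, so its vertices are those lying on an edge.\<close>

type_synonym 'a hypergraph = "'a set set"

definition verts :: "'a hypergraph \<Rightarrow> 'a set" where
  "verts F = \<Union>F"

definition kgraph :: "nat \<Rightarrow> 'a hypergraph \<Rightarrow> bool" where
  "kgraph k F \<longleftrightarrow> finite F \<and> (\<forall>e\<in>F. finite e \<and> card e = k)"

text \<open>
  An n-vertex k-graph lives on a ground set of n vertices, some of which may be isolated.
  (With few color classes the edges cannot cover all n vertices.)
\<close>

definition n_vertex_kgraph :: "nat \<Rightarrow> nat \<Rightarrow> 'a hypergraph \<Rightarrow> bool" where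
  "n_vertex_kgraph n k H \<longleftrightarrow>
     kgraph k H \<and> (\<exists>V. finite V \<and> card V = n \<and> verts H \<subseteq> V)"

definition complete_kgraph :: "nat \<Rightarrow> nat \<Rightarrow> nat hypergraph" where
  "complete_kgraph k t = {e. e \<subseteq> {..<t} \<and> card e = k}"

definition is_copy :: "'a hypergraph \<Rightarrow> 'b hypergraph \<Rightarrow> bool" where
  "is_copy G F \<longleftrightarrow> (\<exists>f. inj_on f (verts F) \<and> G = (\<lambda>e. f ` e) ` F)"

text \<open>
  Terms of a sequence with index below 2 are irrelevant. The bound on the number of vertices
  says that the density is at least 1/(k-1).
\<close>

definition dense_sequence :: "nat \<Rightarrow> (nat \<Rightarrow> 'a hypergraph) \<Rightarrow> bool" where
  "dense_sequence k S \<longleftrightarrow>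
     (\<forall>l\<ge>2. kgraph k (S l) \<and> card (S l) = l \<and> card (verts (S l)) \<le> l * (k - 1))"

text \<open>
  Here \<open>x\<close> need not be an integer: ``x many'' sequences means a set of at most \<open>x\<close> of them.
\<close>

definition union_of_dense_sequences :: "nat \<Rightarrow> real \<Rightarrow> 'a hypergraph set \<Rightarrow> bool" where
  "union_of_dense_sequences k x \<F> \<longleftrightarrow>
     (\<exists>\<S>. finite \<S> \<and> real (card \<S>) \<le> x \<and> (\<forall>S\<in>\<S>. dense_sequence k S) \<and>
          \<F> = (\<Union>S\<in>\<S>. {S l | l. l \<ge> 2}))"

definition edge_coloring :: "'a hypergraph \<Rightarrow> nat \<Rightarrow> ('a set \<Rightarrow> nat) \<Rightarrow> bool" where
  "edge_coloring H m col \<longleftrightarrow> col ` H \<subseteq> {1..m}"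

definition color_class :: "'a hypergraph \<Rightarrow> ('a set \<Rightarrow> nat) \<Rightarrow> nat \<Rightarrow> 'a hypergraph" where
  "color_class H col i = {e\<in>H. col e = i}"

text \<open>
  All \<open>m\<close> color classes are required to be copies of the complete k-graph; in particular no
  color is unused.
\<close>

definition clique_coloring ::
    "nat \<Rightarrow> nat \<Rightarrow> 'a hypergraph \<Rightarrow> nat \<Rightarrow> ('a set \<Rightarrow> nat) \<Rightarrow> bool" where
  "clique_coloring k t H m col \<longleftrightarrow>
     edge_coloring H m col \<and>
     (\<forall>i\<in>{1..m}. is_copy (color_class H col i) (complete_kgraph k t))"

definition rainbow :: "('a set \<Rightarrow> nat) \<Rightarrow> 'a hypergraph \<Rightarrow> bool" where
  "rainbow col G \<longleftrightarrow> inj_on col G"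

definition has_rainbow_copy :: "'a hypergraph \<Rightarrow> ('a set \<Rightarrow> nat) \<Rightarrow> 'b hypergraph \<Rightarrow> bool" where
  "has_rainbow_copy H col F \<longleftrightarrow> (\<exists>G\<subseteq>H. is_copy G F \<and> rainbow col G)"

text \<open>
  A k-graph on n vertices has too few edges, when n is small, for Ln pairwise edge-disjoint
  copies of the complete k-graph on t vertices (none at all if n < t). The following singles out
  the n for which a coloring of the required shape exists, regardless of rainbow copies.
\<close>

definition clique_colorable :: "nat \<Rightarrow> nat \<Rightarrow> nat \<Rightarrow> nat \<Rightarrow> bool" where
  "clique_colorable k t n m \<longleftrightarrow>
     (\<exists>(H :: nat hypergraph) col. n_vertex_kgraph n k H \<and> clique_coloring k t H m col)"

end

theory Submission
  imports Defs "HOL-Library.FuncSet" "HOL-Real_Asymp.Real_Asymp"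
begin

text \<open>
  First moment and deletion. Choose \<open>M = \<lceil>L n\<rceil> + n\<close> random \<open>t\<close>-tuples of vertices, one for each
  potential color, and delete one color for every bad event: a repeated vertex inside a tuple, two
  tuples sharing two vertices, or a rainbow copy of a short \<open>F\<close>. The expected number of events
  of the first two kinds is bounded. An \<open>F\<close> with \<open>l\<close> edges can be placed in at most
  \<open>n^(l (k - 1)) (M t^k)^l\<close> ways, each realised with probability \<open>n^(-k l)\<close>, so it contributes
  at most \<open>(M t^k / n)^l = O(1)^l\<close>, which is at most \<open>n^(\<delta>/2)\<close> for \<open>l < c log n\<close>. Summed over the
  short members of \<open>n^(1 - \<delta>)\<close> sequences this is \<open>o(n)\<close>, so some choice loses at most \<open>n\<close> colors.
  For the finitely many small \<open>n\<close> the bound holds because every \<open>F\<close> has at least two edges.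
\<close>

section \<open>Counting assignments with prescribed values\<close>

text \<open>Such an assignment is determined by its restriction to the indices other than the
  \<open>q j\<close>, and there are \<open>card J\<close> indices \<open>q j\<close> because
  \<open>q\<close> is injective on \<open>J\<close>. The product form says without division that a
  random assignment takes the prescribed values with probability at most n^(-card J).\<close>

lemma card_PiE_prescribed:
  fixes n :: nat
  assumes I: "finite I" and J: "finite J" "inj_on q J" "q ` J \<subseteq> I"
  shows "card {\<omega> \<in> I \<rightarrow>\<^sub>E {..<n}. \<forall>j\<in>J. \<omega> (q j) = w j} * n ^ card J \<le> n ^ card I"
proof -
  let ?E = "{\<omega> \<in> I \<rightarrow>\<^sub>E {..<n}. \<forall>j\<in>J. \<omega> (q j) = w j}"
  let ?R = "\<lambda>\<omega>. restrict \<omega> (I - q ` J)"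
  have "inj_on ?R ?E"
  proof (rule inj_onI)
    fix \<omega> \<omega>' assume a: "\<omega> \<in> ?E" "\<omega>' \<in> ?E" "?R \<omega> = ?R \<omega>'"
    show "\<omega> = \<omega>'"
    proof (rule PiE_ext)
      show "\<omega> \<in> I \<rightarrow>\<^sub>E {..<n}" "\<omega>' \<in> I \<rightarrow>\<^sub>E {..<n}" using a by auto
      fix x assume x: "x \<in> I"
      have "?R \<omega> x = ?R \<omega>' x" using a(3) by metis
      with a(1,2) x show "\<omega> x = \<omega>' x"
        by (cases "x \<in> q ` J") auto
    qed
  qed
  moreover have "?R ` ?E \<subseteq> (I - q ` J) \<rightarrow>\<^sub>E {..<n}"
  proof (rule image_subsetI)
    fix \<omega> assume "\<omega> \<in> ?E"
    then have "\<omega> x \<in> {..<n}" if "x \<in> I" for x using that by (blast intro: PiE_mem)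
    then show "?R \<omega> \<in> (I - q ` J) \<rightarrow>\<^sub>E {..<n}" by (simp add: restrict_PiE_iff)
  qed
  moreover have "finite ((I - q ` J) \<rightarrow>\<^sub>E {..<n})"
    using I by (intro finite_PiE) auto
  ultimately have "card ?E \<le> card ((I - q ` J) \<rightarrow>\<^sub>E {..<n})"
    by (rule card_inj_on_le)
  also have "\<dots> = n ^ (card I - card J)"
    using I J by (simp add: card_PiE card_Diff_subset card_image)
  finally have "card ?E * n ^ card J \<le> n ^ (card I - card J) * n ^ card J"
    by simp
  also have "\<dots> = n ^ card I"
    using card_inj_on_le[OF J(2,3) I] by (simp flip: power_add)
  finally show ?thesis .
qed

text \<open>Linearity of expectation in counting form: after the two sums are swapped, each
  \<open>\<tau>\<close> contributes the number of assignments realising its \<open>r\<close>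
  prescriptions, which the preceding lemma bounds.\<close>

lemma sum_card_prescribed:
  fixes n r :: nat
  assumes I: "finite I" and T: "finite T"
    and J: "\<And>\<tau>. \<tau> \<in> T \<Longrightarrow> finite (J \<tau>) \<and> card (J \<tau>) = r \<and> inj_on (q \<tau>) (J \<tau>) \<and> q \<tau> ` J \<tau> \<subseteq> I"
  shows "(\<Sum>\<omega>\<in>I \<rightarrow>\<^sub>E {..<n}. card {\<tau>\<in>T. \<forall>j\<in>J \<tau>. \<omega> (q \<tau> j) = w \<tau> j}) * n ^ r
           \<le> card T * n ^ card I"
proof -
  let ?O = "I \<rightarrow>\<^sub>E {..<n}"
  let ?P = "\<lambda>\<omega> \<tau>. \<forall>j\<in>J \<tau>. \<omega> (q \<tau> j) = w \<tau> j"
  have fO: "finite ?O" using I by (intro finite_PiE) auto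
  have "(\<Sum>\<omega>\<in>?O. card {\<tau>\<in>T. ?P \<omega> \<tau>}) = (\<Sum>\<omega>\<in>?O. \<Sum>\<tau>\<in>T. if ?P \<omega> \<tau> then 1 else 0)"
    using T by (simp add: sum.If_cases Int_def)
  also have "\<dots> = (\<Sum>\<tau>\<in>T. \<Sum>\<omega>\<in>?O. if ?P \<omega> \<tau> then 1 else 0)"
    by (rule sum.swap)
  also have "\<dots> = (\<Sum>\<tau>\<in>T. card {\<omega>\<in>?O. ?P \<omega> \<tau>})"
    using fO by (simp add: sum.If_cases Int_def)
  finally have "(\<Sum>\<omega>\<in>?O. card {\<tau>\<in>T. ?P \<omega> \<tau>}) * n ^ r = (\<Sum>\<tau>\<in>T. card {\<omega>\<in>?O. ?P \<omega> \<tau>} * n ^ r)"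
    by (simp add: sum_distrib_right)
  also have "\<dots> \<le> (\<Sum>\<tau>\<in>T. n ^ card I)"
  proof (rule sum_mono)
    fix \<tau> assume "\<tau> \<in> T"
    then show "card {\<omega>\<in>?O. ?P \<omega> \<tau>} * n ^ r \<le> n ^ card I"
      using card_PiE_prescribed[OF I, of "J \<tau>" "q \<tau>" n "w \<tau>"] J by auto
  qed
  finally show ?thesis by simp
qed

text \<open>Here \<open>B\<close> bounds the expected number of realised \<open>\<tau>\<close>, and
  \<open>n ^ card I\<close> is the number of all assignments. All three kinds of bad events are
  estimated in this form.\<close>

lemma sum_card_prescribed_real:
  fixes n r :: nat
  assumes "finite I" "finite T" "n > 0"
    and "\<And>\<tau>. \<tau> \<in> T \<Longrightarrow> finite (J \<tau>) \<and> card (J \<tau>) = r \<and> inj_on (q \<tau>) (J \<tau>) \<and> q \<tau> ` J \<tau> \<subseteq> I"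
    and "real (card T) \<le> B * real n ^ r"
  shows "(\<Sum>\<omega>\<in>I \<rightarrow>\<^sub>E {..<n}. real (card {\<tau>\<in>T. \<forall>j\<in>J \<tau>. \<omega> (q \<tau> j) = w \<tau> j}))
           \<le> B * real n ^ card I"
proof -
  let ?s = "\<Sum>\<omega>\<in>I \<rightarrow>\<^sub>E {..<n}. card {\<tau>\<in>T. \<forall>j\<in>J \<tau>. \<omega> (q \<tau> j) = w \<tau> j}"
  have "?s * n ^ r \<le> card T * n ^ card I"
    using assms(1,2,4) by (rule sum_card_prescribed)
  then have "real ?s * real n ^ r \<le> real (card T) * real n ^ card I"
    by (simp only: of_nat_mult of_nat_power flip: of_nat_le_iff[where 'a = real])
  also have "\<dots> \<le> B * real n ^ r * real n ^ card I"
    using assms(5) by (intro mult_right_mono) auto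
  finally have "real ?s \<le> B * real n ^ card I"
    using \<open>n > 0\<close> by (simp add: algebra_simps)
  then show ?thesis by simp
qed

section \<open>From vertex tuples to clique colorings\<close>

text \<open>An edge has two distinct vertices because k >= 2, and by \<open>meet\<close> these lie
  together in the image of at most one tuple. Hence the tuple containing an edge can serve as its
  color. The last conclusion keeps the link from edges back to tuples for the rainbow
  argument.\<close>

lemma coloring_from_tuples:
  fixes a :: "nat \<Rightarrow> nat \<Rightarrow> nat"
  assumes k: "k \<ge> 2"
    and inj: "\<And>i. i \<in> {1..m} \<Longrightarrow> inj_on (a i) {..<t}"
    and sub: "\<And>i. i \<in> {1..m} \<Longrightarrow> a i ` {..<t} \<subseteq> {..<n}"
    and meet: "\<And>i i' x y. i \<in> {1..m} \<Longrightarrow> i' \<in> {1..m} \<Longrightarrow>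
       {x, y} \<subseteq> a i ` {..<t} \<Longrightarrow> {x, y} \<subseteq> a i' ` {..<t} \<Longrightarrow> x \<noteq> y \<Longrightarrow> i = i'"
  obtains H col where "n_vertex_kgraph n k H" "clique_coloring k t H m col"
    "\<And>e. e \<in> H \<Longrightarrow> col e \<in> {1..m} \<and> e \<subseteq> a (col e) ` {..<t}"
proof -
  define H where "H = {e. card e = k \<and> (\<exists>i\<in>{1..m}. e \<subseteq> a i ` {..<t})}"
  \<comment> \<open>The choice is unambiguous on edges: \<open>col_eq\<close> shows that only one
    index qualifies.\<close>
  define col where "col e = (SOME i. i \<in> {1..m} \<and> e \<subseteq> a i ` {..<t})" for e
  have col: "col e \<in> {1..m} \<and> e \<subseteq> a (col e) ` {..<t}" if "e \<in> H" for e
  proof -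
    have "\<exists>i. i \<in> {1..m} \<and> e \<subseteq> a i ` {..<t}" using that unfolding H_def by blast
    then show ?thesis unfolding col_def by (rule someI_ex)
  qed
  have col_eq: "col e = i" if "card e = k" "i \<in> {1..m}" "e \<subseteq> a i ` {..<t}" for e i
  proof -
    have "e \<in> H" using that by (auto simp: H_def)
    have "finite e" "\<not> card e \<le> Suc 0"
      using that(1) k by (auto intro: card_ge_0_finite)
    then obtain x y where "x \<in> e" "y \<in> e" "x \<noteq> y"
      by (auto simp: card_le_Suc0_iff_eq)
    moreover have "e \<subseteq> a (col e) ` {..<t}" "col e \<in> {1..m}" using col[OF \<open>e \<in> H\<close>] by auto
    ultimately show ?thesis using that(2,3) by (intro meet[of "col e" i x y]) blast+
  qed
  have fin: "finite e" if "e \<in> H" for e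
    using that k by (intro card_ge_0_finite) (simp add: H_def)
  have Hsub: "H \<subseteq> Pow {..<n}"
  proof
    fix e assume "e \<in> H"
    then have "e \<subseteq> a (col e) ` {..<t}" "a (col e) ` {..<t} \<subseteq> {..<n}"
      using col[of e] sub[of "col e"] by simp_all
    then show "e \<in> Pow {..<n}" by blast
  qed
  have "n_vertex_kgraph n k H"
    unfolding n_vertex_kgraph_def kgraph_def verts_def
  proof (intro conjI exI[of _ "{..<n}"] ballI)
    show "finite H" using Hsub by (rule finite_subset) simp
    show "\<Union> H \<subseteq> {..<n}" using Hsub by blast
    fix e assume e: "e \<in> H"
    then show "finite e" by (rule fin)
    show "card e = k" using e by (simp add: H_def)
  qed simp_all
  moreover have "is_copy (color_class H col i) (complete_kgraph k t)" if i: "i \<in> {1..m}" for i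
    unfolding is_copy_def
  proof (intro exI conjI)
    show "inj_on (a i) (verts (complete_kgraph k t))"
      using inj[OF i] by (rule inj_on_subset) (auto simp: verts_def complete_kgraph_def)
    show "color_class H col i = (\<lambda>e. a i ` e) ` complete_kgraph k t"
    proof (intro equalityI subsetI)
      fix e assume "e \<in> color_class H col i"
      then have e: "e \<in> H" "e \<subseteq> a i ` {..<t}" using col[of e] by (simp_all add: color_class_def)
      then obtain d where d: "d \<subseteq> {..<t}" "e = a i ` d" by (meson subset_imageE)
      have "card e = k" using e by (simp add: H_def)
      then have "card d = k"
        using d card_image[OF inj_on_subset[OF inj[OF i] d(1)]] by simp
      with d show "e \<in> (\<lambda>e. a i ` e) ` complete_kgraph k t" by (auto simp: complete_kgraph_def)
    next
      fix e assume "e \<in> (\<lambda>e. a i ` e) ` complete_kgraph k t"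
      then obtain d where d: "d \<subseteq> {..<t}" "card d = k" "e = a i ` d"
        by (auto simp: complete_kgraph_def)
      then have e: "card e = k" "e \<subseteq> a i ` {..<t}"
        using card_image[OF inj_on_subset[OF inj[OF i] d(1)]] by auto
      then have "e \<in> H" using i by (auto simp: H_def)
      then show "e \<in> color_class H col i"
        using col_eq[OF e(1) i e(2)] by (simp add: color_class_def)
    qed
  qed
  moreover have "col ` H \<subseteq> {1..m}" using col by blast
  ultimately show thesis
    using col by (intro that[of H col]) (simp_all add: clique_coloring_def edge_coloring_def)
qed

section \<open>Averaging; placements of a hypergraph in the tuples\<close>

lemma ex_le_average:
  fixes f :: "'a \<Rightarrow> real"
  assumes "finite A" "A \<noteq> {}" "sum f A \<le> real (card A) * B"
  obtains x where "x \<in> A" "f x \<le> B"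
proof -
  have "\<exists>x\<in>A. f x \<le> B"
  proof (rule ccontr)
    assume "\<not> ?thesis"
    then have "(\<Sum>x\<in>A. B) < sum f A" using assms by (intro sum_strict_mono) auto
    then show False using assms by simp
  qed
  then show thesis using that by blast
qed

text \<open>
  A map \<open>f\<close> of the vertices of \<open>F\<close>, the colors \<open>g\<close> of the edges, and the position \<open>h (e, v)\<close> of
  each vertex in the tuple of its edge.
\<close>

definition placements ::
  "nat \<Rightarrow> nat \<Rightarrow> nat \<Rightarrow> 'a hypergraph \<Rightarrow> (('a \<Rightarrow> nat) \<times> ('a set \<Rightarrow> nat) \<times> ('a set \<times> 'a \<Rightarrow> nat)) set"
  where "placements n M t F =
    {(f, g, h) \<in> (verts F \<rightarrow>\<^sub>E {..<n}) \<times> (F \<rightarrow>\<^sub>E {..<M}) \<times> (Sigma F (\<lambda>e. e) \<rightarrow>\<^sub>E {..<t}).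
      inj_on g F \<and> (\<forall>e\<in>F. inj_on (\<lambda>v. h (e, v)) e)}"

text \<open>Density enters here: with l = \<open>card F\<close> edges there are at most n^(l (k -
  1)) vertex maps, a factor n^l short of the n^(k l) lost to prescribing k l values. The bound has
  the shape \<open>B * n ^ r\<close> that \<open>sum_card_prescribed_real\<close> expects, with
  \<open>r = k * card F\<close>.\<close>

lemma card_placements:
  assumes F: "kgraph k F" and d: "card (verts F) \<le> card F * (k - 1)" and "k \<ge> 1" "n > 0"
  shows "finite (placements n M t F)"
    and "real (card (placements n M t F))
           \<le> (real M * real t ^ k / real n) ^ card F * real n ^ (k * card F)"
proof -
  let ?S = "(verts F \<rightarrow>\<^sub>E {..<n}) \<times> (F \<rightarrow>\<^sub>E {..<M}) \<times> (Sigma F (\<lambda>e. e) \<rightarrow>\<^sub>E {..<t})"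
  have fin: "finite F" "\<And>e. e \<in> F \<Longrightarrow> finite e" "\<And>e. e \<in> F \<Longrightarrow> card e = k"
    using F by (auto simp: kgraph_def)
  have fv: "finite (verts F)" using fin by (auto simp: verts_def)
  have fs: "finite (Sigma F (\<lambda>e. e))" using fin by auto
  have fS: "finite ?S" using fin fv fs by (intro finite_cartesian_product finite_PiE) auto
  have sub: "placements n M t F \<subseteq> ?S" by (auto simp: placements_def)
  show "finite (placements n M t F)" using sub fS by (rule finite_subset)
  have cs: "card (Sigma F (\<lambda>e. e)) = k * card F" using fin by (simp add: mult.commute)
  have "card (placements n M t F) \<le> card ?S" using fS sub by (rule card_mono)
  also have "\<dots> = n ^ card (verts F) * (M ^ card F * t ^ (k * card F))"
    using fin fv fs cs by (simp add: card_cartesian_product card_PiE mult.commute)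
  also have "\<dots> \<le> n ^ (card F * (k - 1)) * (M ^ card F * t ^ (k * card F))"
    using d \<open>n > 0\<close> by (intro mult_right_mono power_increasing) auto
  finally have "real (card (placements n M t F))
      \<le> real (n ^ (card F * (k - 1)) * (M ^ card F * t ^ (k * card F)))"
    by (rule of_nat_mono)
  also have "\<dots> = real n ^ (card F * (k - 1)) * (real M * real t ^ k) ^ card F"
    by (simp add: power_mult_distrib flip: power_mult)
  also have "\<dots> = (real M * real t ^ k / real n) ^ card F * real n ^ (k * card F)"
  proof -
    have "k * card F = card F * (k - 1) + card F" using \<open>k \<ge> 1\<close> by (cases k) auto
    then show ?thesis using \<open>n > 0\<close> by (simp add: power_add power_divide)
  qed
  finally show "real (card (placements n M t F))
    \<le> (real M * real t ^ k / real n) ^ card F * real n ^ (k * card F)" .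
qed

text \<open>Different edges use different tuples because \<open>g\<close> is injective, and
  \<open>h\<close> separates the vertices within one edge. So no coordinate is prescribed twice, as
  the probability estimate requires.\<close>

lemma inj_on_placement:
  assumes "(f, g, h) \<in> placements n M t F"
  shows "inj_on (\<lambda>(e, v). (g e, h (e, v))) (Sigma F (\<lambda>e. e))"
    and "(\<lambda>(e, v). (g e, h (e, v))) ` Sigma F (\<lambda>e. e) \<subseteq> {..<M} \<times> {..<t}"
proof -
  show "inj_on (\<lambda>(e, v). (g e, h (e, v))) (Sigma F (\<lambda>e. e))"
  proof (rule inj_onI, clarify)
    fix e v e' v' assume ev: "e \<in> F" "v \<in> e" "e' \<in> F" "v' \<in> e'"
      and eq: "g e = g e'" "h (e, v) = h (e', v')"
    have "inj_on g F" and h: "inj_on (\<lambda>v. h (e, v)) e" using assms ev by (auto simp: placements_def)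
    then have "e = e'" using eq(1) ev by (auto dest: inj_onD)
    moreover have "v = v'" using inj_onD[OF h, of v v'] eq(2) ev calculation by simp
    ultimately show "e = e' \<and> v = v'" by simp
  qed
  show "(\<lambda>(e, v). (g e, h (e, v))) ` Sigma F (\<lambda>e. e) \<subseteq> {..<M} \<times> {..<t}"
    using assms unfolding placements_def by (auto simp: PiE_iff)
qed

text \<open>Links copies to bad events: \<open>\<rho>\<close> names the surviving tuple behind each
  color, so a rainbow copy gives a realised placement. The last conclusion, that its edges all use
  surviving tuples, will contradict the deletion of one of them.\<close>

lemma rainbow_placement:
  assumes F: "kgraph k F"
    and G: "G \<subseteq> H" "is_copy G F" "rainbow col G"
    and V: "\<And>e. e \<in> H \<Longrightarrow> e \<subseteq> {..<n}"
    and \<rho>: "inj_on \<rho> (col ` H)" "\<rho> ` col ` H \<subseteq> {..<M}"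
    and a: "\<And>e. e \<in> H \<Longrightarrow> e \<subseteq> (\<lambda>j. \<omega> (\<rho> (col e), j)) ` {..<t}"
  obtains f g h where "(f, g, h) \<in> placements n M t F"
    "\<forall>j\<in>Sigma F (\<lambda>e. e). \<omega> (case j of (e, v) \<Rightarrow> (g e, h (e, v))) = (case j of (e, v) \<Rightarrow> f v)"
    "g ` F \<subseteq> \<rho> ` col ` H"
proof -
  obtain f where f: "inj_on f (verts F)" "G = (\<lambda>e. f ` e) ` F"
    using G by (auto simp: is_copy_def)
  have fe: "f ` e \<in> H" if "e \<in> F" for e using that f G by auto
  have ev: "e \<subseteq> verts F" if "e \<in> F" for e using that by (auto simp: verts_def)
  define g where "g = restrict (\<lambda>e. \<rho> (col (f ` e))) F"
  have "\<exists>j<t. \<omega> (g e, j) = f v" if "e \<in> F" "v \<in> e" for e v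
  proof -
    have "f v \<in> (\<lambda>j. \<omega> (\<rho> (col (f ` e)), j)) ` {..<t}"
      using a[OF fe[OF that(1)]] that by blast
    then show ?thesis using that by (auto simp: g_def)
  qed
  then obtain h0 where h0: "\<And>e v. e \<in> F \<Longrightarrow> v \<in> e \<Longrightarrow> h0 e v < t \<and> \<omega> (g e, h0 e v) = f v"
    by metis
  define h where "h = restrict (\<lambda>(e, v). h0 e v) (Sigma F (\<lambda>e. e))"
  have h: "h (e, v) < t" "\<omega> (g e, h (e, v)) = f v" if "e \<in> F" "v \<in> e" for e v
    using that h0 by (auto simp: h_def)
  \<comment> \<open>This is where the rainbow property is used.\<close>
  have "inj_on g F"
  proof (rule inj_onI)
    fix e e' assume e: "e \<in> F" "e' \<in> F" "g e = g e'"
    then have "\<rho> (col (f ` e)) = \<rho> (col (f ` e'))" by (simp add: g_def)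
    then have "col (f ` e) = col (f ` e')"
      by (rule inj_onD[OF \<rho>(1)]) (intro imageI fe e)+
    then have "f ` e = f ` e'"
      by (rule inj_onD[OF G(3)[unfolded rainbow_def]]) (use e f(2) in simp_all)
    then show "e = e'" using inj_on_image_eq_iff[OF f(1) ev ev] e by simp
  qed
  \<comment> \<open>Equal positions in one tuple hold the same vertex, and \<open>f\<close> is
    injective.\<close>
  moreover have "inj_on (\<lambda>v. h (e, v)) e" if "e \<in> F" for e
  proof (rule inj_onI)
    fix x y assume xy: "x \<in> e" "y \<in> e" "h (e, x) = h (e, y)"
    then have "f x = f y" using h(2)[OF that xy(1)] h(2)[OF that xy(2)] by simp
    then show "x = y" by (rule inj_onD[OF f(1)]) (use ev[OF that] xy in blast)+
  qed
  moreover have "restrict f (verts F) \<in> verts F \<rightarrow>\<^sub>E {..<n}"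
  proof (rule restrict_PiE_iff[THEN iffD2], intro ballI)
    fix v assume "v \<in> verts F"
    then obtain e where "e \<in> F" "v \<in> e" by (auto simp: verts_def)
    then show "f v \<in> {..<n}" using V[OF fe] by blast
  qed
  moreover have "g \<in> F \<rightarrow>\<^sub>E {..<M}" unfolding g_def using \<rho>(2) fe by (intro restrict_PiE_iff[THEN iffD2]) blast
  moreover have "h \<in> Sigma F (\<lambda>e. e) \<rightarrow>\<^sub>E {..<t}" using h0 by (auto simp: h_def)
  ultimately have "(restrict f (verts F), g, h) \<in> placements n M t F"
    by (auto simp: placements_def)
  moreover have "\<forall>j\<in>Sigma F (\<lambda>e. e). \<omega> (case j of (e, v) \<Rightarrow> (g e, h (e, v)))
      = (case j of (e, v) \<Rightarrow> restrict f (verts F) v)"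
    using h(2) by (auto simp: verts_def)
  moreover have "g ` F \<subseteq> \<rho> ` col ` H" using fe unfolding g_def by (simp add: image_subset_iff)
  ultimately show thesis by (rule that)
qed

section \<open>Expected numbers of degenerate and of overlapping tuples\<close>

text \<open>Recording the common value \<open>v\<close> of two equal coordinates turns the event
  into two prescribed values. There are at most M t^2 n records, each realised with probability at
  most n^(-2), and every bad index is the first component of a realised record.\<close>

lemma sum_degenerate_tuples:
  fixes n M t :: nat
  assumes "n > 0"
  defines "I \<equiv> {..<M} \<times> {..<t}"
  shows "(\<Sum>\<omega>\<in>I \<rightarrow>\<^sub>E {..<n}. real (card {i \<in> {..<M}. \<not> inj_on (\<lambda>j. \<omega> (i, j)) {..<t}}))
     \<le> real M * real t ^ 2 / real n * real n ^ card I"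
proof -
  define T where "T = {(i, j, j', v) \<in> {..<M} \<times> {..<t} \<times> {..<t} \<times> {..<n}. j \<noteq> j'}"
  define J where "J = (\<lambda>(i::nat, j::nat, j'::nat, v::nat). {(i, j), (i, j')})"
  define w where "w = (\<lambda>(i::nat, j::nat, j'::nat, v::nat) (x::nat \<times> nat). v)"
  have T: "T \<subseteq> {..<M} \<times> {..<t} \<times> {..<t} \<times> {..<n}" by (auto simp: T_def)
  then have fT: "finite T" by (rule finite_subset) auto
  have "card T \<le> card ({..<M} \<times> {..<t} \<times> {..<t} \<times> {..<n})" using T by (intro card_mono) auto
  then have "real (card T) \<le> real (M * (t * (t * n)))"
    by (intro of_nat_mono) (simp add: card_cartesian_product)
  also have "\<dots> = real M * real t ^ 2 / real n * real n ^ 2"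
    using assms by (simp add: power2_eq_square)
  finally have cT: "real (card T) \<le> \<dots>" .
  have "(\<Sum>\<omega>\<in>I \<rightarrow>\<^sub>E {..<n}. real (card {i \<in> {..<M}. \<not> inj_on (\<lambda>j. \<omega> (i, j)) {..<t}}))
     \<le> (\<Sum>\<omega>\<in>I \<rightarrow>\<^sub>E {..<n}. real (card {\<tau>\<in>T. \<forall>x\<in>J \<tau>. \<omega> (id x) = w \<tau> x}))"
  proof (intro sum_mono of_nat_mono)
    fix \<omega> assume \<omega>: "\<omega> \<in> I \<rightarrow>\<^sub>E {..<n}"
    have "{i \<in> {..<M}. \<not> inj_on (\<lambda>j. \<omega> (i, j)) {..<t}}
      \<subseteq> fst ` {\<tau>\<in>T. \<forall>x\<in>J \<tau>. \<omega> (id x) = w \<tau> x}"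
    proof
      fix i assume "i \<in> {i \<in> {..<M}. \<not> inj_on (\<lambda>j. \<omega> (i, j)) {..<t}}"
      then obtain j j' where j: "i < M" "j < t" "j' < t" "j \<noteq> j'" "\<omega> (i, j) = \<omega> (i, j')"
        by (auto simp: inj_on_def)
      then have "\<omega> (i, j) < n" using \<omega> by (auto simp: I_def PiE_iff)
      then have "(i, j, j', \<omega> (i, j)) \<in> {\<tau>\<in>T. \<forall>x\<in>J \<tau>. \<omega> (id x) = w \<tau> x}"
        using j by (auto simp: T_def J_def w_def)
      then show "i \<in> fst ` {\<tau>\<in>T. \<forall>x\<in>J \<tau>. \<omega> (id x) = w \<tau> x}" by force
    qed
    then show "card {i \<in> {..<M}. \<not> inj_on (\<lambda>j. \<omega> (i, j)) {..<t}}
      \<le> card {\<tau>\<in>T. \<forall>x\<in>J \<tau>. \<omega> (id x) = w \<tau> x}"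
      using fT by (intro surj_card_le) auto
  qed
  also have "\<dots> \<le> real M * real t ^ 2 / real n * real n ^ card I"
  proof (rule sum_card_prescribed_real[where r = 2, OF _ fT assms(1) _ cT])
    show "finite I" by (simp add: I_def)
    fix \<tau> assume "\<tau> \<in> T"
    then show "finite (J \<tau>) \<and> card (J \<tau>) = 2 \<and> inj_on id (J \<tau>) \<and> id ` J \<tau> \<subseteq> I"
      by (auto simp: T_def J_def I_def card_insert_if)
  qed
  finally show ?thesis .
qed

text \<open>The same scheme: an overlap is recorded by two tuples, two positions in each, and the
  shared vertices \<open>x\<close> and \<open>y\<close>. This makes at most M^2 t^4 n^2 records,
  each prescribing four distinct coordinates.\<close>

lemma sum_meeting_tuples:
  fixes n M t :: nat
  assumes "n > 0"
  defines "I \<equiv> {..<M} \<times> {..<t}"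
  shows "(\<Sum>\<omega>\<in>I \<rightarrow>\<^sub>E {..<n}. real (card {i \<in> {..<M}. \<exists>i'\<in>{..<M}. i \<noteq> i' \<and>
        (\<exists>x y. x \<noteq> y \<and> {x, y} \<subseteq> (\<lambda>j. \<omega> (i, j)) ` {..<t} \<and> {x, y} \<subseteq> (\<lambda>j. \<omega> (i', j)) ` {..<t})}))
     \<le> real M ^ 2 * real t ^ 4 / real n ^ 2 * real n ^ card I"
proof -
  let ?U = "{..<M} \<times> {..<M} \<times> {..<t} \<times> {..<t} \<times> {..<t} \<times> {..<t} \<times> {..<n} \<times> {..<n}"
  define T where "T = {(i, i', p, q, p', q', x, y) \<in> ?U. i \<noteq> i' \<and> p \<noteq> q \<and> p' \<noteq> q'}"
  define J where "J = (\<lambda>(i::nat, i'::nat, p::nat, q::nat, p'::nat, q'::nat, x::nat, y::nat).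
     {(i, p), (i, q), (i', p'), (i', q')})"
  \<comment> \<open>On \<open>J \<tau>\<close> the else branch is met only at \<open>(i, q)\<close>
    and \<open>(i', q')\<close>, because \<open>i \<noteq> i'\<close>, \<open>p \<noteq> q\<close>
    and \<open>p' \<noteq> q'\<close> in \<open>T\<close>.\<close>
  define w where "w = (\<lambda>(i::nat, i'::nat, p::nat, q::nat, p'::nat, q'::nat, x::nat, y::nat) s.
     if s = (i, p) \<or> s = (i', p') then x else y)"
  let ?B = "\<lambda>\<omega>. {i \<in> {..<M}. \<exists>i'\<in>{..<M}. i \<noteq> i' \<and>
        (\<exists>x y. x \<noteq> y \<and> {x, y} \<subseteq> (\<lambda>j. \<omega> (i, j)) ` {..<t} \<and> {x, y} \<subseteq> (\<lambda>j. \<omega> (i', j)) ` {..<t})}"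
  have T: "T \<subseteq> ?U" by (auto simp: T_def)
  then have fT: "finite T" by (rule finite_subset) auto
  have "card T \<le> card ?U" using T by (intro card_mono) auto
  then have "real (card T) \<le> real (M * (M * (t * (t * (t * (t * (n * n)))))))"
    by (intro of_nat_mono) (simp add: card_cartesian_product)
  also have "\<dots> = real M ^ 2 * real t ^ 4 / real n ^ 2 * real n ^ 4"
    using assms by (simp add: power2_eq_square power4_eq_xxxx)
  finally have cT: "real (card T) \<le> \<dots>" .
  have "(\<Sum>\<omega>\<in>I \<rightarrow>\<^sub>E {..<n}. real (card (?B \<omega>)))
     \<le> (\<Sum>\<omega>\<in>I \<rightarrow>\<^sub>E {..<n}. real (card {\<tau>\<in>T. \<forall>x\<in>J \<tau>. \<omega> (id x) = w \<tau> x}))"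
  proof (intro sum_mono of_nat_mono)
    fix \<omega> assume \<omega>: "\<omega> \<in> I \<rightarrow>\<^sub>E {..<n}"
    have "?B \<omega> \<subseteq> fst ` {\<tau>\<in>T. \<forall>x\<in>J \<tau>. \<omega> (id x) = w \<tau> x}"
    proof
      fix i assume "i \<in> ?B \<omega>"
      then obtain i' x y where i: "i \<noteq> i'" "{x, y} \<subseteq> (\<lambda>j. \<omega> (i, j)) ` {..<t}"
        "{x, y} \<subseteq> (\<lambda>j. \<omega> (i', j)) ` {..<t}" "x \<noteq> y" "i < M" "i' < M"
        by (elim CollectE conjE bexE exE) (rule that; (assumption | simp only: lessThan_iff))
      have im: "\<exists>j<t. \<omega> (s, j) = z" if "Z \<subseteq> (\<lambda>j. \<omega> (s, j)) ` {..<t}" "z \<in> Z" for s z Z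
        using that by blast
      obtain p q p' q' where p: "p < t" "q < t" "p' < t" "q' < t"
        "\<omega> (i, p) = x" "\<omega> (i, q) = y" "\<omega> (i', p') = x" "\<omega> (i', q') = y"
        using im[OF i(2), of x] im[OF i(2), of y] im[OF i(3), of x] im[OF i(3), of y] by auto
      then have "x < n" "y < n" using \<omega> i by (auto simp: I_def PiE_iff)
      then have "(i, i', p, q, p', q', x, y) \<in> {\<tau>\<in>T. \<forall>x\<in>J \<tau>. \<omega> (id x) = w \<tau> x}"
        using i p by (auto simp: T_def J_def w_def)
      then show "i \<in> fst ` {\<tau>\<in>T. \<forall>x\<in>J \<tau>. \<omega> (id x) = w \<tau> x}" by force
    qed
    then show "card (?B \<omega>) \<le> card {\<tau>\<in>T. \<forall>x\<in>J \<tau>. \<omega> (id x) = w \<tau> x}"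
      using fT by (intro surj_card_le) auto
  qed
  also have "\<dots> \<le> real M ^ 2 * real t ^ 4 / real n ^ 2 * real n ^ card I"
  proof (rule sum_card_prescribed_real[where r = 4, OF _ fT assms(1) _ cT])
    show "finite I" by (simp add: I_def)
    fix \<tau> assume "\<tau> \<in> T"
    then show "finite (J \<tau>) \<and> card (J \<tau>) = 4 \<and> inj_on id (J \<tau>) \<and> id ` J \<tau> \<subseteq> I"
      by (auto simp: T_def J_def I_def card_insert_if)
  qed
  finally show ?thesis .
qed

section \<open>Deleting the bad tuples\<close>

text \<open>The left-hand side of \<open>bound\<close> dominates the expected number of bad events
  among \<open>M\<close> random tuples, and \<open>M - m\<close> tuples may be lost. Some choice
  does no worse than the average, and deleting a tuple for each bad event leaves at least
  \<open>m\<close> of them.\<close>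

lemma rainbow_free_clique_coloring:
  fixes P :: "'a hypergraph set"
  assumes k: "k \<ge> 2" and n: "n > 0" and P: "finite P"
    and F: "\<And>F. F \<in> P \<Longrightarrow> kgraph k F \<and> F \<noteq> {} \<and> card (verts F) \<le> card F * (k - 1)"
    and bound: "real M * real t ^ 2 / real n + real M ^ 2 * real t ^ 4 / real n ^ 2
      + (\<Sum>F\<in>P. (real M * real t ^ k / real n) ^ card F) \<le> real M - real m"
  obtains H :: "nat hypergraph" and col where "n_vertex_kgraph n k H" "clique_coloring k t H m col"
    "\<And>F. F \<in> P \<Longrightarrow> \<not> has_rainbow_copy H col F"
proof -
  define I where "I = {..<M} \<times> {..<t}"
  define \<Omega> where "\<Omega> = I \<rightarrow>\<^sub>E {..<n}"
  define K1 where "K1 \<omega> = {i \<in> {..<M}. \<not> inj_on (\<lambda>j. \<omega> (i, j)) {..<t}}" for \<omega> :: "nat \<times> nat \<Rightarrow> nat"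
  define K2 where "K2 \<omega> = {i \<in> {..<M}. \<exists>i'\<in>{..<M}. i \<noteq> i' \<and>
        (\<exists>x y. x \<noteq> y \<and> {x, y} \<subseteq> (\<lambda>j. \<omega> (i, j)) ` {..<t} \<and> {x, y} \<subseteq> (\<lambda>j. \<omega> (i', j)) ` {..<t})}"
    for \<omega> :: "nat \<times> nat \<Rightarrow> nat"
  \<comment> \<open>Realised placements, written with the position map and the value map that
    \<open>sum_card_prescribed_real\<close> takes.\<close>
  define Q where "Q \<omega> F = {\<tau> \<in> placements n M t F. \<forall>j\<in>Sigma F (\<lambda>e. e).
      \<omega> ((case \<tau> of (f, g, h) \<Rightarrow> \<lambda>(e, v). (g e, h (e, v))) j)
       = (case \<tau> of (f, g, h) \<Rightarrow> \<lambda>(e, v). f v) j}"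
    for \<omega> :: "nat \<times> nat \<Rightarrow> nat" and F :: "'a hypergraph"
  \<comment> \<open>Losing one of its tuples destroys a copy, so only the tuple of one fixed edge of
    \<open>F\<close> is deleted, and \<open>K3\<close> is no larger than \<open>Q\<close>.\<close>
  define K3 where "K3 \<omega> F = (\<lambda>(f, g, h). g (SOME e. e \<in> F)) ` Q \<omega> F"
    for \<omega> and F :: "'a hypergraph"
  have fI: "finite I" by (simp add: I_def)
  have f\<Omega>: "finite \<Omega>" unfolding \<Omega>_def using fI by (intro finite_PiE) auto
  have c\<Omega>: "real (card \<Omega>) = real n ^ card I" unfolding \<Omega>_def using fI by (simp add: card_PiE)
  have fP: "finite (placements n M t F)" if "F \<in> P" for F
    using card_placements(1)[of k F n M t] F[OF that] k n by auto
  have Q: "(\<Sum>\<omega>\<in>\<Omega>. real (card (Q \<omega> F))) \<le> (real M * real t ^ k / real n) ^ card F * real n ^ card I"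
    if "F \<in> P" for F
    unfolding \<Omega>_def Q_def
  proof (rule sum_card_prescribed_real[where r = "k * card F", OF fI fP[OF that] n])
    show "real (card (placements n M t F))
       \<le> (real M * real t ^ k / real n) ^ card F * real n ^ (k * card F)"
      using card_placements(2)[of k F n M t] F[OF that] k n by auto
    fix \<tau> assume \<tau>: "\<tau> \<in> placements n M t F"
    obtain f g h where eq: "\<tau> = (f, g, h)" by (cases \<tau>)
    show "finite (Sigma F (\<lambda>e. e)) \<and> card (Sigma F (\<lambda>e. e)) = k * card F \<and>
       inj_on (case \<tau> of (f, g, h) \<Rightarrow> \<lambda>(e, v). (g e, h (e, v))) (Sigma F (\<lambda>e. e)) \<and>
       (case \<tau> of (f, g, h) \<Rightarrow> \<lambda>(e, v). (g e, h (e, v))) ` Sigma F (\<lambda>e. e) \<subseteq> I"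
      using inj_on_placement[OF \<tau>[unfolded eq]] F[OF that]
      by (auto simp: eq I_def kgraph_def mult.commute)
  qed
  define X where "X \<omega> = real (card (K1 \<omega>)) + real (card (K2 \<omega>)) + (\<Sum>F\<in>P. real (card (Q \<omega> F)))" for \<omega>
  have "sum X \<Omega> = (\<Sum>\<omega>\<in>\<Omega>. real (card (K1 \<omega>))) + (\<Sum>\<omega>\<in>\<Omega>. real (card (K2 \<omega>)))
      + (\<Sum>F\<in>P. \<Sum>\<omega>\<in>\<Omega>. real (card (Q \<omega> F)))"
    unfolding X_def by (simp add: sum.distrib sum.swap[of _ P])
  also have "\<dots> \<le> real M * real t ^ 2 / real n * real n ^ card I
      + real M ^ 2 * real t ^ 4 / real n ^ 2 * real n ^ card I
      + (\<Sum>F\<in>P. (real M * real t ^ k / real n) ^ card F * real n ^ card I)"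
    using sum_degenerate_tuples[OF n, of M t] sum_meeting_tuples[OF n, of M t]
    unfolding K1_def K2_def \<Omega>_def I_def
    by (intro add_mono sum_mono Q[unfolded \<Omega>_def I_def]) auto
  also have "\<dots> = real n ^ card I * (real M * real t ^ 2 / real n + real M ^ 2 * real t ^ 4 / real n ^ 2
      + (\<Sum>F\<in>P. (real M * real t ^ k / real n) ^ card F))"
    by (simp add: algebra_simps sum_distrib_left)
  also have "\<dots> \<le> real (card \<Omega>) * (real M - real m)"
    unfolding c\<Omega> using bound by (intro mult_left_mono) auto
  finally have sumX: "sum X \<Omega> \<le> real (card \<Omega>) * (real M - real m)" .
  have "\<Omega> \<noteq> {}" unfolding \<Omega>_def using n by (auto simp: PiE_eq_empty_iff)
  then obtain \<omega> where \<omega>: "\<omega> \<in> \<Omega>" "X \<omega> \<le> real M - real m"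
    using ex_le_average[OF f\<Omega> _ sumX] by blast
  define K where "K = K1 \<omega> \<union> K2 \<omega> \<union> (\<Union>F\<in>P. K3 \<omega> F)"
  have fQ: "finite (Q \<omega> F)" if "F \<in> P" for F using fP[OF that] by (simp add: Q_def)
  have fK: "finite K" using P fQ by (auto simp: K_def K1_def K2_def K3_def)
  have "card K \<le> card (K1 \<omega>) + card (K2 \<omega>) + (\<Sum>F\<in>P. card (K3 \<omega> F))"
    unfolding K_def
    by (intro order.trans[OF card_Un_le] add_mono card_Un_le card_UN_le P)
  also have "(\<Sum>F\<in>P. card (K3 \<omega> F)) \<le> (\<Sum>F\<in>P. card (Q \<omega> F))"
    unfolding K3_def using fQ by (intro sum_mono card_image_le) auto
  finally have "real (card K) \<le> real (card (K1 \<omega>) + card (K2 \<omega>) + (\<Sum>F\<in>P. card (Q \<omega> F)))"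
    by (simp only: of_nat_le_iff)
  also have "\<dots> = X \<omega>" by (simp add: X_def)
  finally have cK: "real (card K) \<le> real M - real m" using \<omega> by simp
  have "M - card K \<le> card ({..<M} - K)"
    using diff_card_le_card_Diff[OF fK, of "{..<M}"] by simp
  with cK have "m \<le> card ({..<M} - K)" by linarith
  \<comment> \<open>Trimmed to exactly \<open>m\<close> tuples, since every color in
    \<open>{1..m}\<close> must have a clique as its class.\<close>
  then obtain R where R: "R \<subseteq> {..<M} - K" "card R = m" "finite R"
    by (meson obtain_subset_with_card_n)
  then obtain \<rho> where \<rho>: "bij_betw \<rho> {1..m} R"
    by (metis card_atLeastAtMost diff_Suc_1 finite_atLeastAtMost finite_same_card_bij)
  have \<rho>R: "\<rho> i \<in> R" if "i \<in> {1..m}" for i using \<rho> that by (auto simp: bij_betw_def)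
  have \<omega>n: "\<omega> (i, j) < n" if "i < M" "j < t" for i j
    using \<omega>(1) that by (auto simp: \<Omega>_def I_def PiE_iff)
  obtain H col where H: "n_vertex_kgraph n k H" "clique_coloring k t H m col"
    "\<And>e. e \<in> H \<Longrightarrow> col e \<in> {1..m} \<and> e \<subseteq> (\<lambda>j. \<omega> (\<rho> (col e), j)) ` {..<t}"
  proof (rule coloring_from_tuples[where a = "\<lambda>i j. \<omega> (\<rho> i, j)" and m = m and t = t and n = n, OF k])
    fix i assume i: "i \<in> {1..m}"
    show "inj_on (\<lambda>j. \<omega> (\<rho> i, j)) {..<t}"
      using \<rho>R[OF i] R by (auto simp: K_def K1_def)
    show "(\<lambda>j. \<omega> (\<rho> i, j)) ` {..<t} \<subseteq> {..<n}"
      using \<rho>R[OF i] R \<omega>n by auto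
    fix i' x y assume i': "i' \<in> {1..m}" "{x, y} \<subseteq> (\<lambda>j. \<omega> (\<rho> i, j)) ` {..<t}"
      "{x, y} \<subseteq> (\<lambda>j. \<omega> (\<rho> i', j)) ` {..<t}" "x \<noteq> y"
    have "\<rho> i \<notin> K2 \<omega>" "\<rho> i < M" "\<rho> i' < M" using \<rho>R[OF i] \<rho>R[OF i'(1)] R by (auto simp: K_def)
    then have "\<rho> i = \<rho> i'" unfolding K2_def using i' by blast
    then show "i = i'" using \<rho> i i' by (auto simp: bij_betw_def dest: inj_onD)
  qed blast
  have "\<not> has_rainbow_copy H col F" if FP: "F \<in> P" for F
  proof
    assume "has_rainbow_copy H col F"
    then obtain G where G: "G \<subseteq> H" "is_copy G F" "rainbow col G"
      by (auto simp: has_rainbow_copy_def)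
    have colH: "col ` H \<subseteq> {1..m}" using H(3) by blast
    have \<rho>H: "\<rho> ` col ` H \<subseteq> R" using colH \<rho>R by blast
    have inj: "inj_on \<rho> (col ` H)" using \<rho> colH by (auto simp: bij_betw_def intro: inj_on_subset)
    have ran: "\<rho> ` col ` H \<subseteq> {..<M}" using \<rho>H R by blast
    have sub: "e \<subseteq> {..<n}" if "e \<in> H" for e
    proof -
      have "\<rho> (col e) < M" using \<rho>R[of "col e"] H(3)[OF that] R by auto
      then have "(\<lambda>j. \<omega> (\<rho> (col e), j)) ` {..<t} \<subseteq> {..<n}" using \<omega>n by auto
      with H(3)[OF that] show ?thesis by blast
    qed
    obtain f g h where fgh: "(f, g, h) \<in> placements n M t F"
      "\<forall>j\<in>Sigma F (\<lambda>e. e). \<omega> (case j of (e, v) \<Rightarrow> (g e, h (e, v))) = (case j of (e, v) \<Rightarrow> f v)"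
      "g ` F \<subseteq> \<rho> ` col ` H"
      by (rule rainbow_placement[OF conjunct1[OF F[OF FP]] G sub inj ran conjunct2[OF H(3)]])
    have "(f, g, h) \<in> Q \<omega> F" using fgh(1,2) by (simp add: Q_def)
    then have "g (SOME e. e \<in> F) \<in> K3 \<omega> F" by (force simp: K3_def)
    then have "g (SOME e. e \<in> F) \<in> K" using FP by (auto simp: K_def)
    moreover have "(SOME e. e \<in> F) \<in> F" using F[OF FP] by (simp add: some_in_eq)
    \<comment> \<open>The tuple of the fixed edge lies in \<open>K\<close>, yet the placement uses
      only tuples from \<open>R\<close>, which avoids \<open>K\<close>.\<close>
    ultimately show False using fgh(3) \<rho>H R by blast
  qed
  with H(1,2) show thesis by (rule that)
qed

section \<open>Choice of the constants and the final estimate\<close>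

theorem theorem1p13:
  fixes L \<delta> :: real and k t :: nat
  assumes "L \<ge> 0" and "k \<ge> 2" and "t \<ge> k" and "\<delta> > 0"
  shows "\<exists>c>0. \<exists>n0. \<forall>n>0. \<forall>\<F> :: nat hypergraph set.
    (n \<ge> n0 \<or> clique_colorable k t n (nat \<lceil>L * real n\<rceil>)) \<longrightarrow>
    union_of_dense_sequences k (real n powr (1 - \<delta>)) \<F> \<longrightarrow>
    (\<exists>(H :: nat hypergraph) col.
       n_vertex_kgraph n k H \<and>
       clique_coloring k t H (nat \<lceil>L * real n\<rceil>) col \<and>
       (\<forall>F\<in>\<F>. has_rainbow_copy H col F \<longrightarrow> c * ln (real n) \<le> real (card F)))"
proof -
  \<comment> \<open>Bounds the base \<open>M * t ^ k / n\<close> of the contribution of each short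
    hypergraph; the 2 keeps \<open>ln D\<close> positive.\<close>
  define D where "D = max 2 ((L + 2) * real t ^ k)"
  \<comment> \<open>Chosen so that
    \<open>D powr (c0 * ln n) = n powr (\<delta> / 2)\<close>.\<close>
  define c0 where "c0 = \<delta> / (2 * ln D)"
  \<comment> \<open>Bounds the expected numbers of degenerate and overlapping tuples together when M
    <= (L + 2) n.\<close>
  define C where "C = (L + 2) * real t ^ 2 + (L + 2) ^ 2 * real t ^ 4"
  have D: "D > 1" by (simp add: D_def)
  have lnD: "ln D > 0" using D by simp
  have c0: "c0 > 0" using lnD assms by (simp add: c0_def)
  \<comment> \<open>The right-hand side is the number of spare tuples. The left-hand side bounds the
    expected loss: at most n^(1 - \<delta>) c0 ln n short hypergraphs contribute at most
    n^(\<delta>/2) each. Divided by n, it becomes C / n + c0 ln n / n^(\<delta>/2), which tends to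
    0.\<close>
  have "eventually (\<lambda>n. C + real n powr (1 - \<delta>) * (c0 * ln (real n)) * real n powr (\<delta> / 2) \<le> real n) sequentially"
  proof -
    have "(\<lambda>n. ln (real n) / real n powr (\<delta> / 2)) \<longlonglongrightarrow> 0"
      using \<open>\<delta> > 0\<close> by real_asymp
    then have "(\<lambda>n. C / real n + c0 * (ln (real n) / real n powr (\<delta> / 2))) \<longlonglongrightarrow> 0 + c0 * 0"
      by (intro tendsto_intros lim_const_over_n)
    then have "eventually (\<lambda>n. C / real n + c0 * (ln (real n) / real n powr (\<delta> / 2)) < 1) sequentially"
      by (rule order_tendstoD) simp
    then show ?thesis using eventually_gt_at_top[of 0]
    proof eventually_elim
      case (elim n)
      have "real n powr (1 - \<delta>) * real n powr (\<delta> / 2) = real n powr (1 - \<delta> / 2)"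
        by (simp flip: powr_add)
      then have "real n powr (1 - \<delta>) * real n powr (\<delta> / 2) = real n / real n powr (\<delta> / 2)"
        using elim by (simp add: powr_diff)
      then have "C + real n powr (1 - \<delta>) * (c0 * ln (real n)) * real n powr (\<delta> / 2)
          = real n * (C / real n + c0 * (ln (real n) / real n powr (\<delta> / 2)))"
        using elim by (simp add: algebra_simps)
      also have "\<dots> \<le> real n * 1" using elim by (intro mult_left_mono) auto
      finally show ?case by simp
    qed
  qed
  then obtain n0 where n0: "\<And>n. n \<ge> n0 \<Longrightarrow>
     C + real n powr (1 - \<delta>) * (c0 * ln (real n)) * real n powr (\<delta> / 2) \<le> real n"
    by (auto simp: eventually_sequentially)
  \<comment> \<open>The 2 makes \<open>ln N\<close> positive. The second term in the minimum
    defining \<open>c\<close> then gives c ln n <= 2 for all positive n < n0.\<close>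
  define N where "N = max n0 2"
  define c where "c = min c0 (2 / ln (real N))"
  have lnN: "ln (real N) > 0" by (simp add: N_def)
  have c: "c > 0" using c0 lnN by (simp add: c_def)
  show ?thesis
  proof (intro exI[of _ c] exI[of _ n0] conjI c allI impI)
    fix n :: nat and \<F> :: "nat hypergraph set"
    assume n: "n > 0" and col: "n \<ge> n0 \<or> clique_colorable k t n (nat \<lceil>L * real n\<rceil>)"
      and \<F>: "union_of_dense_sequences k (real n powr (1 - \<delta>)) \<F>"
    obtain \<S> where \<S>: "finite \<S>" "real (card \<S>) \<le> real n powr (1 - \<delta>)"
      "\<And>S. S \<in> \<S> \<Longrightarrow> dense_sequence k S" "\<F> = (\<Union>S\<in>\<S>. {S l | l. l \<ge> 2})"
      using \<F> unfolding union_of_dense_sequences_def by blast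
    have card2: "card F \<ge> 2" if "F \<in> \<F>" for F
      using that \<S> by (auto simp: dense_sequence_def)
    show "\<exists>(H :: nat hypergraph) col. n_vertex_kgraph n k H \<and>
       clique_coloring k t H (nat \<lceil>L * real n\<rceil>) col \<and>
       (\<forall>F\<in>\<F>. has_rainbow_copy H col F \<longrightarrow> c * ln (real n) \<le> real (card F))"
    proof (cases "n \<ge> n0")
      \<comment> \<open>Any coloring of the required shape will do here, since every member of the
        family has at least two edges.\<close>
      case False
      then obtain H :: "nat hypergraph" and col where H: "n_vertex_kgraph n k H"
        "clique_coloring k t H (nat \<lceil>L * real n\<rceil>) col"
        using col by (auto simp: clique_colorable_def)
      have "c * ln (real n) \<le> (2 / ln (real N)) * ln (real N)"
        using False n lnN by (intro mult_mono) (auto simp: c_def N_def)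
      also have "\<dots> = 2" using lnN by simp
      finally have "c * ln (real n) \<le> 2" .
      then have "c * ln (real n) \<le> real (card F)" if "F \<in> \<F>" for F
        using card2[OF that] by linarith
      then show ?thesis using H by blast
    next
      case True
      define m where "m = nat \<lceil>L * real n\<rceil>"
      \<comment> \<open>With \<open>n\<close> spare tuples the permitted loss \<open>M - m\<close>
        is exactly \<open>n\<close>.\<close>
      define M where "M = m + n"
      define P where "P = {F \<in> \<F>. real (card F) < c0 * ln (real n)}"
      \<comment> \<open>Rounding up costs at most 1 <= n and the spare tuples add n, hence the
        factor L + 2.\<close>
      have "real m \<le> L * real n + 1" using \<open>L \<ge> 0\<close> by (simp add: m_def of_nat_nat)
      then have M: "real M \<le> (L + 2) * real n" using n by (simp add: M_def algebra_simps)
      have Mn: "real M / real n \<le> L + 2" using M n by (simp add: field_simps)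
      let ?A = "{l. 2 \<le> l \<and> real l < c0 * ln (real n)}"
      let ?y = "c0 * ln (real n)"
      have y: "?y \<ge> 0" using c0 n by simp
      \<comment> \<open>Starting at 1 rather than 0 leaves exactly floor(y) lengths, so
        \<open>card ?A\<close> stays below \<open>?y\<close> without an additive 1.\<close>
      have A: "?A \<subseteq> {1..nat \<lfloor>?y\<rfloor>}" by (auto simp: le_nat_floor)
      then have fA: "finite ?A" by (rule finite_subset) simp
      have "card ?A \<le> nat \<lfloor>?y\<rfloor>" using card_mono[OF _ A] by simp
      then have cA: "real (card ?A) \<le> ?y" using y by linarith
      \<comment> \<open>A short member is named by its sequence and its number of edges, because
        \<open>S l\<close> has exactly \<open>l\<close> edges.\<close>
      have "P \<subseteq> (\<lambda>(S, l). S l) ` (\<S> \<times> ?A)"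
      proof
        fix F assume "F \<in> P"
        then obtain S l where "S \<in> \<S>" "l \<ge> 2" "F = S l" "real (card F) < ?y"
          by (auto simp: P_def \<S>(4))
        moreover have "card F = l" using calculation \<S>(3) by (auto simp: dense_sequence_def)
        ultimately show "F \<in> (\<lambda>(S, l). S l) ` (\<S> \<times> ?A)" by force
      qed
      moreover have fSA: "finite (\<S> \<times> ?A)" using \<S>(1) fA by blast
      ultimately have fP: "finite P" and "card P \<le> card (\<S> \<times> ?A)"
        by (auto intro: finite_surj surj_card_le)
      then have "real (card P) \<le> real (card \<S>) * real (card ?A)"
        by (metis card_cartesian_product of_nat_mono of_nat_mult)
      also have "\<dots> \<le> real n powr (1 - \<delta>) * ?y"
        using \<S>(2) cA by (intro mult_mono) auto
      finally have cP: "real (card P) \<le> real n powr (1 - \<delta>) * ?y" .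
      have "D powr ?y = exp (?y * ln D)" using D by (simp add: powr_def)
      also have "?y * ln D = \<delta> / 2 * ln (real n)" using lnD by (simp add: c0_def)
      also have "exp (\<delta> / 2 * ln (real n)) = real n powr (\<delta> / 2)" using n by (simp add: powr_def)
      finally have Dy: "D powr ?y = real n powr (\<delta> / 2)" .
      have "(real M * real t ^ k / real n) ^ card F \<le> real n powr (\<delta> / 2)" if "F \<in> P" for F
      proof -
        have "real M * real t ^ k / real n = real M / real n * real t ^ k" by simp
        also have "\<dots> \<le> (L + 2) * real t ^ k" using Mn by (intro mult_right_mono) auto
        also have "\<dots> \<le> D" by (simp add: D_def)
        finally have "(real M * real t ^ k / real n) ^ card F \<le> D ^ card F"
          by (intro power_mono) auto
        also have "\<dots> = D powr real (card F)" using D by (simp add: powr_realpow)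
        also have "\<dots> \<le> D powr ?y" using that D by (intro powr_mono) (auto simp: P_def)
        finally show ?thesis by (simp add: Dy)
      qed
      then have "(\<Sum>F\<in>P. (real M * real t ^ k / real n) ^ card F) \<le> real (card P) * real n powr (\<delta> / 2)"
        by (rule sum_bounded_above)
      also have "\<dots> \<le> real n powr (1 - \<delta>) * ?y * real n powr (\<delta> / 2)"
        using cP by (intro mult_right_mono) auto
      finally have b3: "(\<Sum>F\<in>P. (real M * real t ^ k / real n) ^ card F) \<le> \<dots>" .
      have "real M * real t ^ 2 / real n = real M / real n * real t ^ 2" by simp
      also have "\<dots> \<le> (L + 2) * real t ^ 2" using Mn by (intro mult_right_mono) auto
      finally have b1: "real M * real t ^ 2 / real n \<le> (L + 2) * real t ^ 2" .
      have "real M ^ 2 * real t ^ 4 / real n ^ 2 = (real M / real n) ^ 2 * real t ^ 4"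
        by (simp add: power_divide)
      also have "\<dots> \<le> (L + 2) ^ 2 * real t ^ 4"
        using Mn by (intro mult_right_mono power_mono) auto
      finally have b2: "real M ^ 2 * real t ^ 4 / real n ^ 2 \<le> (L + 2) ^ 2 * real t ^ 4" .
      have bound: "real M * real t ^ 2 / real n + real M ^ 2 * real t ^ 4 / real n ^ 2
        + (\<Sum>F\<in>P. (real M * real t ^ k / real n) ^ card F) \<le> real M - real m"
        using b1 b2 b3 n0[OF True] unfolding C_def M_def by simp
      have PF: "kgraph k F \<and> F \<noteq> {} \<and> card (verts F) \<le> card F * (k - 1)" if "F \<in> P" for F
        using that \<S>(3) card2[of F] by (auto simp: P_def \<S>(4) dense_sequence_def)
      obtain H :: "nat hypergraph" and col where H: "n_vertex_kgraph n k H" "clique_coloring k t H m col"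
        "\<And>F. F \<in> P \<Longrightarrow> \<not> has_rainbow_copy H col F"
        using rainbow_free_clique_coloring[OF \<open>k \<ge> 2\<close> n fP PF bound] by blast
      have "c * ln (real n) \<le> real (card F)" if "F \<in> \<F>" "has_rainbow_copy H col F" for F
      proof -
        \<comment> \<open>Since c <= c0, a member with fewer than c ln n edges would lie in
          \<open>P\<close>, whose members have no rainbow copy.\<close>
        have "c * ln (real n) \<le> ?y" using n by (intro mult_right_mono) (auto simp: c_def)
        moreover have "F \<notin> P" using H(3) that by blast
        ultimately show ?thesis using that by (auto simp: P_def)
      qed
      then show ?thesis using H(1,2) unfolding m_def by blast
    qed
  qed
qed

end
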